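(* Let $(S,* )$ and $(T,* )$ be adequate partial semigroups, each with a two-sided identity, let $A$ be a CR set in $S$, and let $B$ be a CR set in $T$. Then $A\times B$ is a CR set in $S\times T$.
   Context: A partial semigroup is a pair $(S,* )$ where $S$ is a nonempty set and $*$ is an operation defined on a nonempty subset of $S\times S$ such that for all $x,y,z\in S$, $(x*y)*z=x*(y*z)$ in the sense that if either side is defined then so is the other and they are equal. A two-sided identity is $e\in S$ with $e*x$ and $x*e$ defined and equal to $x$ for all $x$. $S\times T$ has operation $(a,b)*(c,d)=(a*c,b*d)$, defined iff $a*c$ is defined in $S$ and $b*d$ is defined in $T$. For $a\in S$, $\varphi(a)=\{b\in S: a*b \text{ is defined}\}$; for finite nonempty $F\subseteq S$, $\sigma(F)=\bigcap_{a\in F}\varphi(a)$. A partial semigroup is adequate if $\sigma(F)\neq\emptyset$ for all finite nonempty $F$. $\mathcal{P}_f(X)$ denotes the set of finite nonempty subsets of $X$. Products $\prod_{t\in H}f(t)$ are computed in increasing order of indices. In an adequate partial semigroup $S$, a sequence $f:\mathbb{N}\to S$ is adequate if (i) for each $H\in\mathcal{P}_f(\mathbb{N})$, $\prod_{t\in H}f(t)$ is defined, and (ii) for each $F\in\mathcal{P}_f(S)$ there is $m\in\mathbb{N}$ such that $\prod_{t\in H}f(t)\in\sigma(F)$ for all $H\in\mathcal{P}_f(\mathbb{N})$ with $\min H\geq m$. $\mathcal{T}_S$ denotes the set of adequate sequences in $S$ and $\mathcal{P}_f(\mathcal{T}_S)_{\leq k}=\{F\in\mathcal{P}_f(\mathcal{T}_S):|F|\leq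 k\}$. For $k\in\mathbb{N}$, $A\subseteq S$ is a $k$-CR set in $S$ if for every $L\in\mathcal{P}_f(S)$ there is $r\in\mathbb{N}$ such that for every $F\in\mathcal{P}_f(\mathcal{T}_S)_{\leq k}$ there exist $m\in\mathbb{N}$, $a\in S^{m+1}$ and $t(1)<\dots<t(m)\leq r$ in $\mathbb{N}$ such that for all $f\in F$, $a(1)*f(t(1))*a(2)*\dots*a(m)*f(t(m))*a(m+1)$ is defined and lies in $A\cap\sigma(L)$; $A$ is a CR set if it is $k$-CR for all $k$. The same definitions apply to $T$ and to $S\times T$. *)

theory Defs
  imports "HOL-Library.FuncSet"
begin

text \<open>Throughout, \<open>\<nat>\<close> means the positive integers, represented as \<open>{1..} :: nat set\<close>.
  A partial operation is a function into \<open>option\<close>; \<open>None\<close> means ``undefined''.\<close>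

record 'a psg =
  elts :: "'a set"
  pmul :: "'a \<Rightarrow> 'a \<Rightarrow> 'a option"

text \<open>The strong associativity law is an equation between \<open>option\<close> values: either side is
  defined iff the other one is, and then they are equal.\<close>

definition partial_semigroup :: "'a psg \<Rightarrow> bool" where
  "partial_semigroup S \<longleftrightarrow>
     elts S \<noteq> {} \<and>
     (\<forall>x y z. pmul S x y = Some z \<longrightarrow> x \<in> elts S \<and> y \<in> elts S \<and> z \<in> elts S) \<and>
     (\<exists>x y. pmul S x y \<noteq> None) \<and>
     (\<forall>x\<in>elts S. \<forall>y\<in>elts S. \<forall>z\<in>elts S.
        Option.bind (pmul S x y) (\<lambda>u. pmul S u z) = Option.bind (pmul S y z) (\<lambda>v. pmul S x v))"

definition two_sided_identity :: "'a psg \<Rightarrow> 'a \<Rightarrow> bool" where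
  "two_sided_identity S e \<longleftrightarrow>
     e \<in> elts S \<and> (\<forall>x\<in>elts S. pmul S e x = Some x \<and> pmul S x e = Some x)"

definition prod_psg :: "'a psg \<Rightarrow> 'b psg \<Rightarrow> ('a \<times> 'b) psg" where
  "prod_psg S T =
     \<lparr> elts = elts S \<times> elts T,
       pmul = (\<lambda>(a, b) (c, d).
         Option.bind (pmul S a c) (\<lambda>u. Option.bind (pmul T b d) (\<lambda>v. Some (u, v)))) \<rparr>"

definition Pf :: "'a set \<Rightarrow> 'a set set" where
  "Pf X = {F. F \<subseteq> X \<and> finite F \<and> F \<noteq> {}}"

definition phi :: "'a psg \<Rightarrow> 'a \<Rightarrow> 'a set" where
  "phi S a = {b \<in> elts S. pmul S a b \<noteq> None}"

definition sigma :: "'a psg \<Rightarrow> 'a set \<Rightarrow> 'a set" where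
  "sigma S F = (\<Inter>a\<in>F. phi S a)"

definition adequate_psg :: "'a psg \<Rightarrow> bool" where
  "adequate_psg S \<longleftrightarrow> partial_semigroup S \<and> (\<forall>F\<in>Pf (elts S). sigma S F \<noteq> {})"

text \<open>The product of a nonempty word, bracketed to the right. By strong associativity,
  neither definedness nor the value depends on the bracketing in a partial semigroup.
  The empty word has no product.\<close>

fun word_prod :: "'a psg \<Rightarrow> 'a list \<Rightarrow> 'a option" where
  "word_prod S [] = None"
| "word_prod S [x] = Some x"
| "word_prod S (x # y # ys) = Option.bind (word_prod S (y # ys)) (pmul S x)"

definition seq_prod :: "'a psg \<Rightarrow> (nat \<Rightarrow> 'a) \<Rightarrow> nat set \<Rightarrow> 'a option" where
  "seq_prod S f H = word_prod S (map f (sorted_list_of_set H))"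

text \<open>Sequences are extensional functions on the positive integers, so that distinct
  elements of the following set are distinct sequences and \<open>card\<close> counts them correctly.\<close>

definition adequate_seqs :: "'a psg \<Rightarrow> (nat \<Rightarrow> 'a) set" where
  "adequate_seqs S =
     {f \<in> {1..} \<rightarrow>\<^sub>E elts S.
        (\<forall>H\<in>Pf {1..}. seq_prod S f H \<noteq> None) \<and>
        (\<forall>F\<in>Pf (elts S). \<exists>m\<ge>1. \<forall>H\<in>Pf {1..}. m \<le> Min H \<longrightarrow>
           (\<exists>x\<in>sigma S F. seq_prod S f H = Some x))}"

text \<open>The word \<open>a(1) f(t(1)) a(2) f(t(2)) \<dots> a(m) f(t(m)) a(m+1)\<close>.\<close>

definition interleave ::
    "nat \<Rightarrow> (nat \<Rightarrow> 'a) \<Rightarrow> (nat \<Rightarrow> nat) \<Rightarrow> (nat \<Rightarrow> 'a) \<Rightarrow> 'a list" where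
  "interleave m a t f = concat (map (\<lambda>i. [a i, f (t i)]) [1..<m + 1]) @ [a (m + 1)]"

definition k_CR_set :: "nat \<Rightarrow> 'a psg \<Rightarrow> 'a set \<Rightarrow> bool" where
  "k_CR_set k S A \<longleftrightarrow> A \<subseteq> elts S \<and>
     (\<forall>L\<in>Pf (elts S). \<exists>r\<ge>1. \<forall>F\<in>Pf (adequate_seqs S). card F \<le> k \<longrightarrow>
        (\<exists>m\<ge>1. \<exists>a\<in>{1..m + 1} \<rightarrow> elts S. \<exists>t\<in>{1..m} \<rightarrow> {1..}.
           strict_mono_on {1..m} t \<and> t m \<le> r \<and>
           (\<forall>f\<in>F. \<exists>x\<in>A \<inter> sigma S L. word_prod S (interleave m a t f) = Some x)))"

definition CR_set :: "'a psg \<Rightarrow> 'a set \<Rightarrow> bool" where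
  "CR_set S A \<longleftrightarrow> (\<forall>k\<ge>1. k_CR_set k S A)"

text \<open>The Cartesian product is again an adequate partial semigroup, so that the notion of a
  CR set in it makes sense.\<close>

lemma pmul_prod_psg_eq_Some:
  "pmul (prod_psg S T) p q = Some w \<longleftrightarrow>
     pmul S (fst p) (fst q) = Some (fst w) \<and> pmul T (snd p) (snd q) = Some (snd w)"
  by (cases p; cases q; cases w) (auto simp: prod_psg_def bind_eq_Some_conv)

lemma partial_semigroup_prod_psg:
  assumes S: "partial_semigroup S" and T: "partial_semigroup T"
  shows "partial_semigroup (prod_psg S T)"
proof -
  have elts: "elts (prod_psg S T) = elts S \<times> elts T"
    by (simp add: prod_psg_def)
  have ex: "\<exists>p q. pmul (prod_psg S T) p q \<noteq> None"
  proof -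
    obtain x y z where "pmul S x y = Some z"
      using S by (auto simp: partial_semigroup_def)
    moreover obtain x' y' z' where "pmul T x' y' = Some z'"
      using T by (auto simp: partial_semigroup_def)
    ultimately have "pmul (prod_psg S T) (x, x') (y, y') = Some (z, z')"
      by (simp add: pmul_prod_psg_eq_Some)
    then show ?thesis by blast
  qed
  have assoc: "Option.bind (pmul (prod_psg S T) p q) (\<lambda>u. pmul (prod_psg S T) u s) =
      Option.bind (pmul (prod_psg S T) q s) (\<lambda>v. pmul (prod_psg S T) p v)"
    if p: "p \<in> elts S \<times> elts T" and q: "q \<in> elts S \<times> elts T" and s: "s \<in> elts S \<times> elts T"
    for p q s
  proof -
    obtain a1 a2 b1 b2 c1 c2 where eq: "p = (a1, a2)" "q = (b1, b2)" "s = (c1, c2)"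
      by (metis surj_pair)
    have 1: "Option.bind (pmul S a1 b1) (\<lambda>u. pmul S u c1) =
        Option.bind (pmul S b1 c1) (\<lambda>v. pmul S a1 v)"
      using S p q s by (simp add: partial_semigroup_def eq)
    have 2: "Option.bind (pmul T a2 b2) (\<lambda>u. pmul T u c2) =
        Option.bind (pmul T b2 c2) (\<lambda>v. pmul T a2 v)"
      using T p q s by (simp add: partial_semigroup_def eq)
    show ?thesis
      using 1 2
      by (cases "pmul S a1 b1"; cases "pmul S b1 c1"; cases "pmul T a2 b2"; cases "pmul T b2 c2")
        (auto simp: prod_psg_def eq split: bind_splits)
  qed
  have "elts S \<times> elts T \<noteq> {}"
    using S T by (auto simp: partial_semigroup_def)
  moreover have "x \<in> elts S \<times> elts T \<and> y \<in> elts S \<times> elts T \<and> z \<in> elts S \<times> elts T"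
    if "pmul (prod_psg S T) x y = Some z" for x y z
    using that S T unfolding pmul_prod_psg_eq_Some partial_semigroup_def
    by (metis mem_Times_iff)
  ultimately show ?thesis
    unfolding partial_semigroup_def elts using ex assoc by blast
qed

lemma adequate_psg_prod_psg:
  assumes S: "adequate_psg S" and T: "adequate_psg T"
  shows "adequate_psg (prod_psg S T)"
  unfolding adequate_psg_def
proof (intro conjI ballI)
  show "partial_semigroup (prod_psg S T)"
    using S T by (simp add: adequate_psg_def partial_semigroup_prod_psg)
next
  fix F assume F: "F \<in> Pf (elts (prod_psg S T))"
  then have "fst ` F \<in> Pf (elts S)" "snd ` F \<in> Pf (elts T)"
    by (auto simp: Pf_def prod_psg_def)
  then obtain b c where b: "b \<in> sigma S (fst ` F)" and c: "c \<in> sigma T (snd ` F)"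
    using S T by (meson adequate_psg_def ex_in_conv)
  have "(b, c) \<in> phi (prod_psg S T) p" if "p \<in> F" for p
  proof -
    have "b \<in> phi S (fst p)" "c \<in> phi T (snd p)"
      using that b c by (auto simp: sigma_def)
    then show ?thesis
      by (cases p) (auto simp: phi_def prod_psg_def)
  qed
  then have "(b, c) \<in> sigma (prod_psg S T) F"
    unfolding sigma_def by blast
  then show "sigma (prod_psg S T) F \<noteq> {}"
    by blast
qed

end

theory Submission
  imports Defs
begin

text \<open>
  Fix \<open>L\<close> and a finite set \<open>F\<close> of adequate sequences in \<open>S\<close>, and let \<open>\<A>\<close> be the set of those finite
  sets \<open>H = {t(1) < \<dots> < t(m)}\<close> for which suitable \<open>a(i)\<close> bring all the products into \<open>A \<inter> \<sigma>(L)\<close>.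
  Given \<open>H(1) < H(2) < \<dots>\<close>, the products of \<open>f \<in> F\<close> over these blocks form at most \<open>|F|\<close> adequate
  sequences; the CR property applied to them yields a union of some of the first \<open>r\<close> blocks, and
  putting the identity between the factors of a block shows that this union belongs to \<open>\<A>\<close>.
  So \<open>\<A>\<close> meets the finite unions of every sequence of \<open>r\<close> blocks, with \<open>r\<close> independent of \<open>F\<close>,
  and likewise the set \<open>\<B>\<close> belonging to \<open>T\<close> and \<open>B\<close> with some \<open>r'\<close>. By the finite unions theorem,
  here obtained from a finitary version of Baumgartner's proof of Hindman's theorem, \<open>\<A>\<close> contains
  all finite unions of some \<open>r'\<close> blocks inside a bounded interval; one of these unions lies in \<open>\<B>\<close>.
\<close>

section \<open>The finite unions theorem\<close>

definition FU :: "nat set set \<Rightarrow> nat set set" where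
  "FU X = {\<Union>Z | Z. Z \<subseteq> X \<and> Z \<noteq> {}}"

definition before :: "nat set \<Rightarrow> nat set \<Rightarrow> bool" where
  "before H K \<longleftrightarrow> (\<forall>h\<in>H. \<forall>k\<in>K. h < k)"

definition blocks :: "nat set list \<Rightarrow> bool" where
  "blocks D \<longleftrightarrow> sorted_wrt before D \<and> set D \<subseteq> Pf {1..}"

text \<open>A quantitative form of Baumgartner's largeness: \<open>n\<close> bounds how many blocks
  are needed to force a union into \<open>G\<close>. It is vacuous for a list \<open>D\<close> of
  fewer than \<open>n\<close> blocks, so the lemmas that extract something from it also ask for a
  long list.\<close>

definition large :: "nat set set \<Rightarrow> nat \<Rightarrow> nat set list \<Rightarrow> bool" where
  "large G n D \<longleftrightarrow>
     (\<forall>ys. blocks ys \<longrightarrow> length ys = n \<longrightarrow> set ys \<subseteq> FU (set D) \<longrightarrow> FU (set ys) \<inter> G \<noteq> {})"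

section \<open>Unions of nonempty subfamilies, and their order\<close>

lemma FU_empty [simp]: "FU {} = {}"
  by (auto simp: FU_def)

lemma FU_mono: "X \<subseteq> Y \<Longrightarrow> FU X \<subseteq> FU Y"
  unfolding FU_def by blast

lemma FU_incl: "X \<subseteq> FU X"
proof
  fix x assume "x \<in> X"
  then show "x \<in> FU X"
    unfolding FU_def by (auto intro!: exI[of _ "{x}"])
qed

lemma FU_insert: "FU (insert x X) = insert x (FU X \<union> (\<lambda>y. x \<union> y) ` FU X)" (is "?l = ?r")
proof
  show "?l \<subseteq> ?r"
  proof
    fix y assume "y \<in> ?l"
    then obtain Z where Z: "Z \<subseteq> insert x X" "Z \<noteq> {}" "y = \<Union>Z"
      by (auto simp: FU_def)
    show "y \<in> ?r"
    proof (cases "x \<in> Z")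
      case False
      with Z show ?thesis by (auto simp: FU_def)
    next
      case True
      show ?thesis
      proof (cases "Z - {x} = {}")
        case True
        with \<open>x \<in> Z\<close> have "Z = {x}" by blast
        with Z show ?thesis by simp
      next
        case False
        with Z have "\<Union>(Z - {x}) \<in> FU X" by (auto simp: FU_def)
        moreover have "y = x \<union> \<Union>(Z - {x})" using Z \<open>x \<in> Z\<close> by blast
        ultimately show ?thesis by blast
      qed
    qed
  qed
  show "?r \<subseteq> ?l"
  proof -
    have "x \<union> \<Union>Z \<in> ?l" if "Z \<subseteq> X" for Z
      using that unfolding FU_def by (auto intro!: exI[of _ "insert x Z"])
    moreover have "x \<in> ?l" using FU_incl by blast
    moreover have "FU X \<subseteq> ?l" by (rule FU_mono) blast
    ultimately show ?thesis by (auto simp: FU_def)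
  qed
qed

lemma FU_FU: "FU (FU X) \<subseteq> FU X"
proof
  fix y assume "y \<in> FU (FU X)"
  then obtain Z where Z: "Z \<subseteq> FU X" "Z \<noteq> {}" "y = \<Union>Z"
    by (auto simp: FU_def)
  from Z(1) have "\<forall>z\<in>Z. \<exists>W. W \<subseteq> X \<and> W \<noteq> {} \<and> \<Union>W = z"
    unfolding FU_def by blast
  then obtain W where W: "\<And>z. z \<in> Z \<Longrightarrow> W z \<subseteq> X" "\<And>z. z \<in> Z \<Longrightarrow> W z \<noteq> {}"
      "\<And>z. z \<in> Z \<Longrightarrow> \<Union>(W z) = z"
    by metis
  have "y = (\<Union>z\<in>Z. \<Union>(W z))" using Z(3) W(3) by simp
  also have "\<dots> = \<Union>(\<Union>z\<in>Z. W z)" by blast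
  finally have "y = \<Union>(\<Union>z\<in>Z. W z)" .
  moreover have "(\<Union>z\<in>Z. W z) \<subseteq> X" using W(1) by blast
  moreover have "(\<Union>z\<in>Z. W z) \<noteq> {}" using W(2) Z(2) by simp
  ultimately show "y \<in> FU X" unfolding FU_def by blast
qed

lemma FU_subsetI: "X \<subseteq> FU Y \<Longrightarrow> FU X \<subseteq> FU Y"
  using FU_mono FU_FU by blast

lemma FU_Pf: "finite X \<Longrightarrow> X \<subseteq> Pf U \<Longrightarrow> FU X \<subseteq> Pf U"
  by (fastforce simp: FU_def Pf_def dest: finite_subset)

lemma finite_FU: "finite X \<Longrightarrow> finite (FU X)"
  and card_FU: "finite X \<Longrightarrow> card (FU X) \<le> 2 ^ card X"
proof -
  have *: "FU X \<subseteq> Union ` Pow X" by (auto simp: FU_def)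
  show "finite (FU X)" if "finite X"
    using that * by (meson finite_Pow_iff finite_imageI finite_subset)
  show "card (FU X) \<le> 2 ^ card X" if "finite X"
    using card_mono[OF _ *] card_image_le[of "Pow X" Union] that
    by (simp add: card_Pow)
qed

lemma before_FU:
  assumes "\<forall>x\<in>X. \<forall>y\<in>Y. before x y" "x \<in> FU X" "y \<in> FU Y"
  shows "before x y"
  using assms by (fastforce simp: FU_def before_def)

lemma blocks_append:
  "blocks (xs @ ys) \<longleftrightarrow> blocks xs \<and> blocks ys \<and> (\<forall>x\<in>set xs. \<forall>y\<in>set ys. before x y)"
  by (auto simp: blocks_def sorted_wrt_append)

lemma blocks_append_refine:
  assumes "blocks (xs @ ys)" "blocks xs'" "blocks ys'"
    "set xs' \<subseteq> FU (set xs)" "set ys' \<subseteq> FU (set ys)"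
  shows "blocks (xs' @ ys')"
  using assms before_FU[of "set xs" "set ys"] unfolding blocks_append by blast

lemma blocks_singleton: "blocks D \<Longrightarrow> x \<in> FU (set D) \<Longrightarrow> blocks [x]"
  using FU_Pf[of "set D" "{1..}"] by (auto simp: blocks_def)

section \<open>Largeness: refinement, partition regularity and Baumgartner's iteration\<close>

lemma large_refine: "large G n D \<Longrightarrow> set D' \<subseteq> FU (set D) \<Longrightarrow> large G n D'"
  unfolding large_def using FU_subsetI by blast

text \<open>Largeness along \<open>D\<close> only sees the part of \<open>G\<close> inside
  \<open>FU (set D)\<close>, since unions of unions are unions. So a covering of \<open>G\<close>
  that is valid only among the unions of \<open>D\<close> may replace \<open>G\<close>.\<close>

lemma large_mono:
  assumes "large G n D" "G \<inter> FU (set D) \<subseteq> G'"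
  shows "large G' n D"
  unfolding large_def
proof (intro allI impI)
  fix ys assume ys: "blocks ys" "length ys = n" "set ys \<subseteq> FU (set D)"
  then have "FU (set ys) \<inter> G \<noteq> {}" using assms(1) by (simp add: large_def)
  then show "FU (set ys) \<inter> G' \<noteq> {}"
    using FU_subsetI[OF ys(3)] assms(2) by blast
qed

lemma large_nonempty: "large G n D \<Longrightarrow> blocks D \<Longrightarrow> n \<le> length D \<Longrightarrow> FU (set D) \<inter> G \<noteq> {}"
proof -
  assume a: "large G n D" "blocks D" "n \<le> length D"
  have "blocks (take n D)"
    using a(2) append_take_drop_id[of n D] blocks_append by metis
  moreover have "set (take n D) \<subseteq> set D" by (rule set_take_subset)
  ultimately show ?thesis
    using a(1,3) FU_incl[of "set D"] FU_mono[of "set (take n D)" "set D"]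
    unfolding large_def by (metis (no_types, lifting) disjoint_iff length_take min.absorb2 subset_eq)
qed

text \<open>If every chunk of \<open>M\<close> blocks contains some \<open>d\<close> for which no translate \<open>e \<union> d\<close> lies in \<open>G\<close>,
  then appending \<open>x \<union> d\<close> rather than \<open>d\<close> alone keeps all unions of the new sequence outside \<open>G\<close>.\<close>

lemma avoiding_extension:
  assumes "blocks (ys @ D)" "FU (set ys) \<inter> G = {}" "length D = i * Suc M"
  shows "(\<exists>E D'. blocks (E @ D') \<and> set (E @ D') \<subseteq> FU (set (ys @ D)) \<and> length E \<le> length ys + i \<and>
            length D' = M \<and> (\<forall>d\<in>FU (set D'). \<exists>e\<in>FU (set E). e \<union> d \<in> G)) \<or>
         (\<exists>zs. blocks zs \<and> set zs \<subseteq> FU (set (ys @ D)) \<and> length zs = length ys + i \<and>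
            FU (set zs) \<inter> G = {})"
  using assms
proof (induction i arbitrary: ys D)
  case 0
  then show ?case using FU_incl by (intro disjI2 exI[of _ ys]) auto
next
  case (Suc i)
  then obtain x D1 where D: "D = x # D1"
    by (metis Suc_neq_Zero length_0_conv list.exhaust mult_is_0)
  define C where "C = take M D1"
  define R where "R = drop M D1"
  have D1: "D1 = C @ R" by (simp add: C_def R_def)
  have len: "length C = M" "length R = i * Suc M"
    using Suc.prems(3) by (auto simp: D C_def R_def)
  have bl2: "blocks ((ys @ [x] @ C) @ R)"
    using Suc.prems(1) by (simp add: D D1)
  then have "blocks (ys @ [x] @ C)"
    unfolding blocks_append[of "ys @ [x] @ C"] by blast
  then have bl1: "blocks ((ys @ [x]) @ C)" by simp
  show ?case
  proof (cases "\<forall>d\<in>FU (set C). \<exists>e\<in>FU (set (ys @ [x])). e \<union> d \<in> G")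
    case True
    then show ?thesis
      using bl1 len FU_incl[of "set (ys @ D)"]
      by (intro disjI1 exI[of _ "ys @ [x]"] exI[of _ C]) (auto simp: D D1)
  next
    case False
    then obtain d where d: "d \<in> FU (set C)" "\<forall>e\<in>FU (set (ys @ [x])). e \<union> d \<notin> G"
      by blast
    let ?y = "x \<union> d"
    have xd: "?y \<in> FU (set ([x] @ C))"
      using d(1) by (auto simp: FU_insert)
    have b2: "blocks (ys @ [x] @ C)" using bl1 by simp
    then have "blocks ([x] @ C)" and bys: "blocks ys" unfolding blocks_append by auto
    then have by1: "blocks [?y]" using blocks_singleton xd by blast
    have b3: "blocks (ys @ [?y])"
      using blocks_append_refine[OF b2 bys by1] xd FU_incl by auto
    have sub: "set (ys @ [?y]) \<subseteq> FU (set (ys @ [x] @ C))"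
      using xd FU_mono[of "set ([x] @ C)" "set (ys @ [x] @ C)"] FU_incl[of "set (ys @ [x] @ C)"]
      by auto
    have "blocks R" using bl2 unfolding blocks_append by blast
    then have b4: "blocks ((ys @ [?y]) @ R)"
      using blocks_append_refine[OF bl2 b3 _ sub] FU_incl by blast
    \<comment> \<open>The set \<open>d\<close> itself may lie in \<open>G\<close>; only its
      translates avoid \<open>G\<close>. With \<open>x\<close> attached, every union involving the
      new block regroups as a translate of \<open>d\<close> by \<open>x\<close> or by
      \<open>x \<union> e\<close>, both in \<open>FU (set (ys @ [x]))\<close>.\<close>
    have e: "FU (set (ys @ [?y])) \<inter> G = {}"
    proof -
      have "x \<union> d \<notin> G" using d(2) by (auto simp: FU_insert)
      moreover have "(x \<union> d) \<union> e \<notin> G" if "e \<in> FU (set ys)" for e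
      proof -
        have "x \<union> e \<in> FU (set (ys @ [x]))" using that by (simp add: FU_insert)
        then show ?thesis using d(2) by (metis sup_assoc sup_commute)
      qed
      ultimately show ?thesis using Suc.prems(2) by (auto simp: FU_insert)
    qed
    have "set ((ys @ [?y]) @ R) \<subseteq> FU (set (ys @ D))"
      using sub FU_mono[of "set (ys @ [x] @ C)" "set (ys @ D)"] FU_incl[of "set (ys @ D)"]
      by (auto simp: D D1)
    then have sub2: "FU (set ((ys @ [?y]) @ R)) \<subseteq> FU (set (ys @ D))" by (rule FU_subsetI)
    from Suc.IH[OF b4 e len(2)] show ?thesis
    proof (elim disjE exE conjE)
      fix E D'
      assume "blocks (E @ D')" "set (E @ D') \<subseteq> FU (set ((ys @ [?y]) @ R))"
        "length E \<le> length (ys @ [?y]) + i" "length D' = M"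
        "\<forall>d\<in>FU (set D'). \<exists>e\<in>FU (set E). e \<union> d \<in> G"
      then show ?thesis
        by (intro disjI1 exI[of _ E] exI[of _ D'] conjI subset_trans[OF _ sub2]) simp_all
    next
      fix zs
      assume "blocks zs" "set zs \<subseteq> FU (set ((ys @ [?y]) @ R))"
        "length zs = length (ys @ [?y]) + i" "FU (set zs) \<inter> G = {}"
      then show ?thesis
        by (intro disjI2 exI[of _ zs] conjI subset_trans[OF _ sub2]) simp_all
    qed
  qed
qed

text \<open>Start the avoiding construction from the empty list: its second outcome would be
  \<open>n\<close> blocks with no union in \<open>G\<close>, against largeness. The bound on the
  length of \<open>E\<close> leaves at most \<open>2 ^ n\<close> translating sets \<open>e\<close>
  to distinguish later.\<close>

lemma large_translates:
  assumes "blocks D" "large G n D" "length D = n * Suc M"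
  shows "\<exists>E D'. blocks (E @ D') \<and> set (E @ D') \<subseteq> FU (set D) \<and> length E \<le> n \<and>
            length D' = M \<and> (\<forall>d\<in>FU (set D'). \<exists>e\<in>FU (set E). e \<union> d \<in> G)"
  using avoiding_extension[of "[]" D G n M] assms by (auto simp: large_def)

text \<open>Partition regularity. Either a set \<open>H j\<close> already meets the unions of every
  \<open>N\<close> blocks, or some \<open>N\<close> blocks miss it altogether and the union of the
  other sets is still large along these. The new bound \<open>n'\<close> is not known in advance, so
  an arbitrary function \<phi> prescribes how long \<open>D'\<close> must be in terms of it.\<close>

lemma large_partition:
  "\<exists>N. \<forall>D (H :: nat set \<Rightarrow> nat set set) I. blocks D \<longrightarrow> N \<le> length D \<longrightarrow> finite I \<longrightarrow> card I \<le> q \<longrightarrow>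
     large (\<Union>i\<in>I. H i) n D \<longrightarrow>
     (\<exists>i\<in>I. \<exists>n' D'. blocks D' \<and> set D' \<subseteq> FU (set D) \<and> \<phi> n' \<le> length D' \<and> large (H i) n' D')"
proof (induction q)
  case 0
  show ?case
    by (rule exI[of _ n]) (use large_nonempty[of "{}"] in auto)
next
  case (Suc q)
  then obtain N where N: "\<And>D (H :: nat set \<Rightarrow> nat set set) I. \<lbrakk>blocks D; N \<le> length D; finite I; card I \<le> q;
     large (\<Union>i\<in>I. H i) n D\<rbrakk> \<Longrightarrow>
     \<exists>i\<in>I. \<exists>n' D'. blocks D' \<and> set D' \<subseteq> FU (set D) \<and> \<phi> n' \<le> length D' \<and> large (H i) n' D'"
    by blast
  show ?case
  \<comment> \<open>\<open>N\<close> is the length that suffices for \<open>q\<close> sets. Length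
    \<open>n\<close> guarantees that \<open>I\<close> is nonempty; \<open>\<phi> N\<close> pays for
    the case in which \<open>D\<close> itself is the answer, with \<open>n' = N\<close>.\<close>
  proof (intro exI[of _ "max n (\<phi> N)"] allI impI)
    fix D I and H :: "nat set \<Rightarrow> nat set set"
    assume D: "blocks D" "max n (\<phi> N) \<le> length D" and I: "finite I" "card I \<le> Suc q"
      and lg: "large (\<Union>i\<in>I. H i) n D"
    have "I \<noteq> {}" using large_nonempty[OF lg D(1)] D(2) by auto
    then obtain j where j: "j \<in> I" by blast
    show "\<exists>i\<in>I. \<exists>n' D'. blocks D' \<and> set D' \<subseteq> FU (set D) \<and> \<phi> n' \<le> length D' \<and> large (H i) n' D'"
    proof (cases "large (H j) N D")
      case True
      then show ?thesis
        using D j FU_incl[of "set D"] by (intro bexI[OF _ j] exI[of _ N] exI[of _ D]) auto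
    next
      case False
      then obtain D1 where D1: "blocks D1" "length D1 = N" "set D1 \<subseteq> FU (set D)"
          "FU (set D1) \<inter> H j = {}"
        unfolding large_def by blast
      have "large (\<Union>i\<in>I - {j}. H i) n D1"
        by (rule large_mono[OF large_refine[OF lg D1(3)]]) (use D1(4) in blast)
      moreover have "card (I - {j}) \<le> q" using I j by simp
      ultimately obtain i n' D' where "i \<in> I - {j}" "blocks D'" "set D' \<subseteq> FU (set D1)"
          "\<phi> n' \<le> length D'" "large (H i) n' D'"
        using N[of D1 "I - {j}" H] D1(1,2) I(1) by auto
      moreover have "set D' \<subseteq> FU (set D)"
        using \<open>set D' \<subseteq> FU (set D1)\<close> FU_subsetI[OF D1(3)] by (rule subset_trans)
      ultimately show ?thesis by (intro bexI[of _ i] exI[of _ n'] exI[of _ D']) simp_all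
    qed
  qed
qed

text \<open>Every union \<open>d\<close> in a suitable tail has a translate
  \<open>e \<union> d\<close> in \<open>G\<close> with \<open>e\<close> from a short initial list,
  so \<open>G\<close> splits there into at most \<open>2 ^ n\<close> pieces according to
  \<open>e\<close>, and one piece is large further on. Nothing yet puts \<open>e\<close> itself into
  \<open>G\<close>.\<close>

lemma large_step:
  "\<exists>M. \<forall>D G. blocks D \<longrightarrow> M \<le> length D \<longrightarrow> large G n D \<longrightarrow>
     (\<exists>e D' n'. blocks (e # D') \<and> set (e # D') \<subseteq> FU (set D) \<and> \<phi> n' \<le> length D' \<and>
        large {d \<in> G. e \<union> d \<in> G} n' D')"
proof -
  obtain N where N: "\<And>D (H :: nat set \<Rightarrow> nat set set) I. \<lbrakk>blocks D; N \<le> length D; finite I; card I \<le> 2 ^ n;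
     large (\<Union>i\<in>I. H i) n D\<rbrakk> \<Longrightarrow>
     \<exists>i\<in>I. \<exists>n' D'. blocks D' \<and> set D' \<subseteq> FU (set D) \<and> \<phi> n' \<le> length D' \<and> large (H i) n' D'"
    using large_partition[of "2 ^ n" n \<phi>] by blast
  show ?thesis
  \<comment> \<open>The length is chosen so that \<open>N\<close> blocks survive the search for
    translates, as the partition into pieces requires.\<close>
  proof (intro exI[of _ "n * Suc N"] allI impI)
    fix D0 G
    assume D0: "blocks D0" "n * Suc N \<le> length D0" "large G n D0"
    define D where "D = take (n * Suc N) D0"
    have "blocks (D @ drop (n * Suc N) D0)" "length D = n * Suc N"
      using D0(1,2) by (simp_all add: D_def del: mult_Suc_right)
    then have D: "blocks D" "length D = n * Suc N"
      unfolding blocks_append by blast+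
    have DD0: "set D \<subseteq> FU (set D0)"
      unfolding D_def using set_take_subset FU_incl by fast
    have "large G n D" using large_refine[OF D0(3) DD0] .
    then obtain E D1 where E: "blocks (E @ D1)" "set (E @ D1) \<subseteq> FU (set D)" "length E \<le> n"
        "length D1 = N" "\<forall>d\<in>FU (set D1). \<exists>e\<in>FU (set E). e \<union> d \<in> G"
      using large_translates D by metis
    have "large G n D1" using large_refine[OF \<open>large G n D\<close>] E(2) by simp
    then have "large (\<Union>e\<in>FU (set E). {d \<in> G. e \<union> d \<in> G}) n D1"
      by (rule large_mono) (use E(5) in blast)
    moreover have "card (FU (set E)) \<le> 2 ^ n"
    proof -
      have "card (set E) \<le> n" using card_length[of E] E(3) by linarith
      then have "(2::nat) ^ card (set E) \<le> 2 ^ n" by (simp add: power_increasing)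
      with card_FU[of "set E"] show ?thesis by (meson List.finite_set order_trans)
    qed
    ultimately obtain e n' D' where e: "e \<in> FU (set E)" and D': "blocks D'" "set D' \<subseteq> FU (set D1)"
        "\<phi> n' \<le> length D'" "large {d \<in> G. e \<union> d \<in> G} n' D'"
      using N[of D1 "FU (set E)" "\<lambda>e. {d \<in> G. e \<union> d \<in> G}"] E(1,4) finite_FU[of "set E"]
      by (auto simp: blocks_append)
    have "blocks [e]" using e E(1) blocks_singleton blocks_append by blast
    then have "blocks ([e] @ D')"
      using blocks_append_refine[OF E(1) \<open>blocks [e]\<close> D'(1)] e D'(2) by simp
    moreover have "set (e # D') \<subseteq> FU (set D0)"
    proof -
      have "e \<in> FU (set (E @ D1))" using e FU_mono[of "set E" "set (E @ D1)"] by auto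
      moreover have "set D' \<subseteq> FU (set (E @ D1))"
        using D'(2) FU_mono[of "set D1" "set (E @ D1)"] by auto
      ultimately show ?thesis using FU_subsetI[OF E(2)] FU_subsetI[OF DD0] by auto
    qed
    ultimately show "\<exists>e D' n'. blocks (e # D') \<and> set (e # D') \<subseteq> FU (set D0) \<and> \<phi> n' \<le> length D' \<and>
        large {d \<in> G. e \<union> d \<in> G} n' D'"
      using D'(3,4) by auto
  qed
qed

text \<open>Iterates the previous step, each time inside the set already found. The length needed
  for the remaining steps depends on the bound \<open>n1\<close> returned by the first one;
  therefore the function \<open>M\<close> from the induction hypothesis is passed to
  \<open>large_step\<close> as its \<phi>.\<close>

lemma large_steps:
  "\<exists>M. \<forall>D G. blocks D \<longrightarrow> M \<le> length D \<longrightarrow> large G n D \<longrightarrow>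
     (\<exists>es D' n'. length es = j \<and> blocks (es @ D') \<and> set (es @ D') \<subseteq> FU (set D) \<and> \<phi> n' \<le> length D' \<and>
        large {d \<in> G. \<forall>e\<in>FU (set es). e \<union> d \<in> G} n' D')"
proof (induction j arbitrary: n)
  case 0
  show ?case by (intro exI[of _ "\<phi> n"] allI impI) (use FU_incl in auto)
next
  case (Suc j)
  have "\<exists>M. \<forall>n. \<forall>D G. blocks D \<longrightarrow> M n \<le> length D \<longrightarrow> large G n D \<longrightarrow>
     (\<exists>es D' n'. length es = j \<and> blocks (es @ D') \<and> set (es @ D') \<subseteq> FU (set D) \<and> \<phi> n' \<le> length D' \<and>
        large {d \<in> G. \<forall>e\<in>FU (set es). e \<union> d \<in> G} n' D')"
    by (rule choice, rule allI, rule Suc)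
  then obtain M where M: "\<And>n D G. \<lbrakk>blocks D; M n \<le> length D; large G n D\<rbrakk> \<Longrightarrow>
     \<exists>es D' n'. length es = j \<and> blocks (es @ D') \<and> set (es @ D') \<subseteq> FU (set D) \<and> \<phi> n' \<le> length D' \<and>
        large {d \<in> G. \<forall>e\<in>FU (set es). e \<union> d \<in> G} n' D'"
    by blast
  obtain K where K: "\<And>D G. \<lbrakk>blocks D; K \<le> length D; large G n D\<rbrakk> \<Longrightarrow>
     \<exists>e D' n'. blocks (e # D') \<and> set (e # D') \<subseteq> FU (set D) \<and> M n' \<le> length D' \<and>
        large {d \<in> G. e \<union> d \<in> G} n' D'"
    using large_step[of n M] by blast
  show ?case
  proof (intro exI[of _ K] allI impI)
    fix D G assume D: "blocks D" "K \<le> length D" "large G n D"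
    then obtain e D1 n1 where D1: "blocks ([e] @ D1)" "set (e # D1) \<subseteq> FU (set D)"
        "M n1 \<le> length D1" "large {d \<in> G. e \<union> d \<in> G} n1 D1"
      using K by (metis append_Cons append_Nil)
    then have b: "blocks [e]" "blocks D1" unfolding blocks_append by auto
    let ?G = "{d \<in> G. e \<union> d \<in> G}"
    obtain es D' n' where es: "length es = j" "blocks (es @ D')" "set (es @ D') \<subseteq> FU (set D1)"
        "\<phi> n' \<le> length D'" "large {d \<in> ?G. \<forall>e\<in>FU (set es). e \<union> d \<in> ?G} n' D'"
      using M[OF b(2) D1(3,4)] by blast
    have "blocks ([e] @ es @ D')"
      using blocks_append_refine[OF D1(1) b(1) es(2) _ es(3)] FU_incl by simp
    \<comment> \<open>For \<open>e'\<close> in \<open>FU (set es)\<close>,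
      \<open>e' \<union> d \<in> ?G\<close> also says
      \<open>e \<union> e' \<union> d \<in> G\<close>, which takes care of the unions of
      \<open>e # es\<close> that combine \<open>e\<close> with later blocks.\<close>
    moreover have "{d \<in> ?G. \<forall>e\<in>FU (set es). e \<union> d \<in> ?G} \<subseteq>
        {d \<in> G. \<forall>e\<in>FU (set (e # es)). e \<union> d \<in> G}"
      by (auto simp: FU_insert Un_assoc)
    then have "large {d \<in> G. \<forall>e\<in>FU (set (e # es)). e \<union> d \<in> G} n' D'"
      using large_mono[OF es(5)] by blast
    moreover have "set ((e # es) @ D') \<subseteq> FU (set D)"
      using es(3) D1(2) FU_subsetI[of "set D1" "set D"] by auto
    ultimately show "\<exists>es D' n'. length es = Suc j \<and> blocks (es @ D') \<and> set (es @ D') \<subseteq> FU (set D) \<and>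
        \<phi> n' \<le> length D' \<and> large {d \<in> G. \<forall>e\<in>FU (set es). e \<union> d \<in> G} n' D'"
      using es(1,4) by (intro exI[of _ "e # es"] exI[of _ D'] exI[of _ n']) simp
  qed
qed

text \<open>A single step need not give \<open>e \<in> G\<close>, but after \<open>n\<close> steps
  some union \<open>e\<close> of the chosen blocks lies in \<open>G\<close> by largeness. Recursing
  inside the set of those \<open>d\<close> for which \<open>d\<close> and
  \<open>e \<union> d\<close> are in \<open>G\<close> gives the other blocks. \<open>M\<close>
  depends only on \<open>n\<close> and \<open>r\<close>, not on \<open>G\<close>; this uniformity
  later makes the bound independent of the sequences.\<close>

lemma finite_unions:
  "\<exists>M. \<forall>D G. blocks D \<longrightarrow> M \<le> length D \<longrightarrow> large G n D \<longrightarrow>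
     (\<exists>ys. length ys = r \<and> blocks ys \<and> set ys \<subseteq> FU (set D) \<and> FU (set ys) \<subseteq> G)"
proof (induction r arbitrary: n)
  case 0
  show ?case by (auto simp: blocks_def)
next
  case (Suc r)
  have "\<exists>M. \<forall>n. \<forall>D G. blocks D \<longrightarrow> M n \<le> length D \<longrightarrow> large G n D \<longrightarrow>
     (\<exists>ys. length ys = r \<and> blocks ys \<and> set ys \<subseteq> FU (set D) \<and> FU (set ys) \<subseteq> G)"
    by (rule choice, rule allI, rule Suc)
  then obtain M where M: "\<And>n D G. \<lbrakk>blocks D; M n \<le> length D; large G n D\<rbrakk> \<Longrightarrow>
     \<exists>ys. length ys = r \<and> blocks ys \<and> set ys \<subseteq> FU (set D) \<and> FU (set ys) \<subseteq> G"
    by blast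
  obtain K where K: "\<And>D G. \<lbrakk>blocks D; K \<le> length D; large G n D\<rbrakk> \<Longrightarrow>
     \<exists>es D' n'. length es = n \<and> blocks (es @ D') \<and> set (es @ D') \<subseteq> FU (set D) \<and> M n' \<le> length D' \<and>
        large {d \<in> G. \<forall>e\<in>FU (set es). e \<union> d \<in> G} n' D'"
    using large_steps[of n n M] by blast
  show ?case
  proof (intro exI[of _ K] allI impI)
    fix D G assume D: "blocks D" "K \<le> length D" "large G n D"
    let ?G = "\<lambda>es. {d \<in> G. \<forall>e\<in>FU (set es). e \<union> d \<in> G}"
    obtain es D' n' where es: "length es = n" "blocks (es @ D')" "set (es @ D') \<subseteq> FU (set D)"
        "M n' \<le> length D'" "large (?G es) n' D'"
      using K[OF D] by blast
    have b: "blocks es" "blocks D'" using es(2) unfolding blocks_append by auto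
    obtain e where e: "e \<in> FU (set es)" "e \<in> G"
      using D(3) b(1) es(1,3) unfolding large_def by fastforce
    obtain ys where ys: "length ys = r" "blocks ys" "set ys \<subseteq> FU (set D')" "FU (set ys) \<subseteq> ?G es"
      using M[OF b(2) es(4,5)] by blast
    have "blocks ([e] @ ys)"
      using blocks_append_refine[OF es(2) blocks_singleton[OF b(1) e(1)] ys(2) _ ys(3)] e(1) by simp
    moreover have "set (e # ys) \<subseteq> FU (set D)"
      using FU_subsetI[of "set es" "set D"] FU_subsetI[of "set D'" "set D"] es(3) e(1) ys(3) by auto
    moreover have "FU (set (e # ys)) \<subseteq> G"
      using e ys(4) by (auto simp: FU_insert)
    ultimately show "\<exists>ys. length ys = Suc r \<and> blocks ys \<and> set ys \<subseteq> FU (set D) \<and> FU (set ys) \<subseteq> G"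
      using ys(1) by (intro exI[of _ "e # ys"]) simp
  qed
qed

section \<open>Words over a partial semigroup\<close>

locale unital_psg =
  fixes S :: "'a psg" and e :: 'a
  assumes partial_semigroup: "partial_semigroup S" and identity: "two_sided_identity S e"
begin

section \<open>Products in the presence of an identity\<close>

lemma e_elts [simp]: "e \<in> elts S"
  and mul_e [simp]: "x \<in> elts S \<Longrightarrow> pmul S e x = Some x" "x \<in> elts S \<Longrightarrow> pmul S x e = Some x"
  using identity by (auto simp: two_sided_identity_def)

lemma pmul_closed: "pmul S x y = Some z \<Longrightarrow> z \<in> elts S"
  using partial_semigroup by (auto simp: partial_semigroup_def)

lemma pmul_assoc:
  "x \<in> elts S \<Longrightarrow> y \<in> elts S \<Longrightarrow> z \<in> elts S \<Longrightarrow>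
    Option.bind (pmul S x y) (\<lambda>u. pmul S u z) = Option.bind (pmul S y z) (pmul S x)"
  using partial_semigroup by (auto simp: partial_semigroup_def)

text \<open>The empty word gets the identity here, unlike in \<open>word_prod\<close>, so that
  splitting and joining words needs no case for an empty part.\<close>

primrec unital_prod :: "'a list \<Rightarrow> 'a option" where
  "unital_prod [] = Some e"
| "unital_prod (x # xs) = Option.bind (unital_prod xs) (pmul S x)"

lemma word_prod_eq_unital_prod: "w \<noteq> [] \<Longrightarrow> set w \<subseteq> elts S \<Longrightarrow> word_prod S w = unital_prod w"
  by (induction w rule: induct_list012) auto

lemma unital_prod_closed: "set w \<subseteq> elts S \<Longrightarrow> unital_prod w = Some x \<Longrightarrow> x \<in> elts S"
  using e_elts by (cases w) (auto simp: bind_eq_Some_conv dest: pmul_closed simp del: e_elts)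

lemma unital_prod_e_Cons: "set w \<subseteq> elts S \<Longrightarrow> unital_prod (e # w) = unital_prod w"
  using unital_prod_closed[of w] by (cases "unital_prod w") auto

text \<open>Strong associativity carries definedness as well as values across brackets, hence an
  equation between \<open>option\<close> values.\<close>

lemma unital_prod_append:
  assumes "set u \<subseteq> elts S" "set v \<subseteq> elts S"
  shows "unital_prod (u @ v) = Option.bind (unital_prod u) (\<lambda>x. Option.bind (unital_prod v) (pmul S x))"
  using assms(1)
proof (induction u)
  case Nil
  show ?case using unital_prod_e_Cons[OF assms(2)] by simp
next
  case (Cons x u)
  show ?case
  proof (cases "unital_prod u")
    case None
    then show ?thesis using Cons by simp
  next
    case (Some y)
    then have y: "y \<in> elts S" using Cons.prems unital_prod_closed[of u y] by simp
    show ?thesis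
    proof (cases "unital_prod v")
      case None
      then show ?thesis using Cons Some by (cases "pmul S x y") simp_all
    next
      case (Some z)
      then have "z \<in> elts S" using assms(2) unital_prod_closed[of v z] by simp
      then show ?thesis
        using Cons \<open>unital_prod u = Some y\<close> Some y pmul_assoc[of x y z] by simp
    qed
  qed
qed

end

text \<open>A word \<open>a(1) f(t(1)) a(2) \<dots> f(t(m)) a(m+1)\<close> is encoded by its first letter \<open>a(1)\<close> and the
  list of the pairs \<open>(t(i), a(i+1))\<close>, from which \<open>fill\<close> produces the remaining letters.\<close>

definition fill :: "(nat \<Rightarrow> 'a) \<Rightarrow> (nat \<times> 'a) list \<Rightarrow> 'a list" where
  "fill f ps = concat (map (\<lambda>(t, a). [f t, a]) ps)"

lemma fill_simps [simp]:
  "fill f [] = []"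
  "fill f ((t, a) # ps) = f t # a # fill f ps"
  "fill f (ps @ qs) = fill f ps @ fill f qs"
  by (simp_all add: fill_def)

lemma set_fill: "set (fill f ps) = f ` fst ` set ps \<union> snd ` set ps"
  by (induction ps) (simp, clarsimp, blast)

lemma fill_cong: "(\<And>t. t \<in> fst ` set ps \<Longrightarrow> f t = g t) \<Longrightarrow> fill f ps = fill g ps"
  unfolding fill_def by (rule arg_cong[of _ _ concat]) force

lemma interleave_eq_fill:
  "interleave m a t f = a 1 # fill f (map (\<lambda>i. (t i, a (i + 1))) [1..<m + 1])"
  by (induction m) (simp_all add: interleave_def)

text \<open>The family \<A> of the opening comment, with \<open>C\<close> standing for
  \<open>A \<inter> sigma S L\<close>. Only the index set is retained: the letters
  \<open>a(i)\<close> may be chosen separately for \<open>S\<close> and \<open>T\<close>, while the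
  indices must agree.\<close>

definition solutions :: "'a psg \<Rightarrow> 'a set \<Rightarrow> (nat \<Rightarrow> 'a) set \<Rightarrow> nat set set" where
  "solutions S C F = {H \<in> Pf {1..}. \<exists>a\<in>elts S. \<exists>ps. map fst ps = sorted_list_of_set H \<and>
     snd ` set ps \<subseteq> elts S \<and> (\<forall>f\<in>F. \<exists>x\<in>C. word_prod S (a # fill f ps) = Some x)}"

section \<open>CR sets in terms of index sets\<close>

lemma sorted_list_of_set_image:
  assumes "strict_mono_on {1..m::nat} (t :: nat \<Rightarrow> nat)"
  shows "sorted_list_of_set (t ` {1..m}) = map t [1..<m + 1]"
proof -
  have "sorted_wrt (<) (map t [1..<m + 1])"
    unfolding sorted_wrt_map
    using sorted_wrt_upt[of 1 "m + 1"]
    by (rule sorted_wrt_mono_rel[rotated]) (use assms in \<open>auto simp: strict_mono_on_def\<close>)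
  moreover have "set (map t [1..<m + 1]) = t ` {1..m}" by auto
  ultimately show ?thesis
    by (metis sorted_list_of_set.idem_if_sorted_distinct strict_sorted_iff)
qed

lemma k_CR_set_iff_solutions:
  "k_CR_set k S A \<longleftrightarrow> A \<subseteq> elts S \<and>
     (\<forall>L\<in>Pf (elts S). \<exists>r\<ge>1. \<forall>F\<in>Pf (adequate_seqs S). card F \<le> k \<longrightarrow>
        (\<exists>H\<in>solutions S (A \<inter> sigma S L) F. H \<subseteq> {1..r}))"
proof -
  have "(\<exists>m\<ge>1. \<exists>a\<in>{1..m + 1} \<rightarrow> elts S. \<exists>t\<in>{1..m} \<rightarrow> {1..}.
           strict_mono_on {1..m} t \<and> t m \<le> r \<and>
           (\<forall>f\<in>F. \<exists>x\<in>C. word_prod S (interleave m a t f) = Some x)) \<longleftrightarrow>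
        (\<exists>H\<in>solutions S C F. H \<subseteq> {1..r})" (is "?l \<longleftrightarrow> ?r") for F C r
  proof
    assume ?l
    then obtain m a t where *: "m \<ge> 1" "a \<in> {1..m + 1} \<rightarrow> elts S" "t \<in> {1..m} \<rightarrow> {1..}"
        "strict_mono_on {1..m} t" "t m \<le> r"
        "\<forall>f\<in>F. \<exists>x\<in>C. word_prod S (interleave m a t f) = Some x"
      by blast
    let ?ps = "map (\<lambda>i. (t i, a (i + 1))) [1..<m + 1]"
    have "t i \<le> r" if "i \<in> {1..m}" for i
      using that *(1,4,5) strict_mono_onD[OF *(4), of i m] by (cases "i = m") auto
    then have "t ` {1..m} \<subseteq> {1..r}" using *(3) by (auto simp: Pi_iff)
    moreover have "t ` {1..m} \<in> Pf {1..}" using *(1,3) by (auto simp: Pf_def)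
    moreover have "map fst ?ps = sorted_list_of_set (t ` {1..m})"
      using sorted_list_of_set_image[OF *(4)] by simp
    moreover have "a 1 \<in> elts S" "snd ` set ?ps \<subseteq> elts S" using *(2) by auto
    ultimately show ?r
      using *(6) unfolding interleave_eq_fill solutions_def by blast
  next
    assume ?r
    then obtain H a0 ps where *: "H \<in> Pf {1..}" "H \<subseteq> {1..r}" "a0 \<in> elts S"
        "map fst ps = sorted_list_of_set H" "snd ` set ps \<subseteq> elts S"
        "\<forall>f\<in>F. \<exists>x\<in>C. word_prod S (a0 # fill f ps) = Some x"
      by (auto simp: solutions_def)
    define m where "m = length ps"
    \<comment> \<open>The pair at position \<open>i - 1\<close> of \<open>ps\<close> holds
      \<open>t(i)\<close> and the letter \<open>a(i+1)\<close>, so \<open>a(i)\<close> for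
      \<open>i > 1\<close> sits at position \<open>i - 2\<close>; the letter \<open>a(1)\<close>
      stands outside \<open>ps\<close>.\<close>
    define t where "t i = fst (ps ! (i - 1))" for i
    define a where "a i = (if i = 1 then a0 else snd (ps ! (i - 2)))" for i
    have H: "set (map fst ps) = H" "sorted_wrt (<) (map fst ps)"
      using *(1) unfolding *(4) by (auto simp: Pf_def)
    have "map (\<lambda>i. (t i, a (i + 1))) [1..<m + 1] = ps"
      by (rule nth_equalityI) (simp_all add: t_def a_def m_def del: upt_Suc)
    then have ps: "interleave m a t f = a0 # fill f ps" for f
      by (simp add: interleave_eq_fill a_def)
    have th: "t i \<in> H" if "i \<in> {1..m}" for i
      using that unfolding H(1)[symmetric] t_def m_def by auto
    have m: "m \<ge> 1" using *(1) H(1) by (cases ps) (auto simp: m_def Pf_def)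
    have "a \<in> {1..m + 1} \<rightarrow> elts S"
      using *(3,5) unfolding a_def m_def by (auto simp: image_subset_iff)
    moreover have "t \<in> {1..m} \<rightarrow> {1..}" using th *(1) unfolding Pf_def Pi_iff by blast
    moreover have "t m \<le> r" using th[of m] m *(2) by auto
    moreover have "strict_mono_on {1..m} t"
      unfolding strict_mono_on_def
    proof (intro allI impI)
      fix i j assume "i \<in> {1..m} \<and> j \<in> {1..m} \<and> i < j"
      then show "t i < t j"
        using sorted_wrt_nth_less[OF H(2), of "i - 1" "j - 1"] by (auto simp: t_def m_def)
    qed
    ultimately show ?l using *(6) m unfolding ps[symmetric] by blast
  qed
  then show ?thesis unfolding k_CR_set_def by simp
qed

section \<open>Replacing letters by whole blocks\<close>

context unital_psg
begin

text \<open>Pairs whose \<open>fill\<close> word is the product over a block, followed by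
  \<open>a\<close>, in disguise: identities occupy the inner gaps.\<close>

fun expand :: "nat list \<Rightarrow> 'a \<Rightarrow> (nat \<times> 'a) list" where
  "expand [] a = []"
| "expand [t] a = [(t, a)]"
| "expand (t # u # ts) a = (t, e) # expand (u # ts) a"

lemma map_fst_expand [simp]: "map fst (expand ts a) = ts"
  by (induction ts a rule: expand.induct) auto

lemma snd_expand: "snd ` set (expand ts a) \<subseteq> {e, a}"
  by (induction ts a rule: expand.induct) auto

lemma set_fill_expand:
  assumes "f ` set ts \<subseteq> elts S" "a \<in> elts S"
  shows "set (fill f (expand ts a)) \<subseteq> elts S"
proof -
  have "fst ` set (expand ts a) = set ts"
    using arg_cong[OF map_fst_expand[of ts a], of set] by (simp only: set_map)
  moreover have "snd ` set (expand ts a) \<subseteq> elts S"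
    using snd_expand[of ts a] assms(2) e_elts by blast
  ultimately show ?thesis using assms(1) unfolding set_fill by simp
qed

lemma unital_prod_fill_expand:
  "ts \<noteq> [] \<Longrightarrow> f ` set ts \<subseteq> elts S \<Longrightarrow> a \<in> elts S \<Longrightarrow>
    unital_prod (fill f (expand ts a)) = unital_prod (map f ts @ [a])"
proof (induction ts a rule: expand.induct)
  case (3 t u ts a)
  let ?w = "fill f (expand (u # ts) a)"
  have "unital_prod (fill f (expand (t # u # ts) a)) = Option.bind (unital_prod (e # ?w)) (pmul S (f t))"
    by simp
  also have "unital_prod (e # ?w) = unital_prod ?w"
    by (rule unital_prod_e_Cons, rule set_fill_expand) (use 3 in auto)
  also have "\<dots> = unital_prod (map f (u # ts) @ [a])"
    using 3 by simp
  finally show ?case by simp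
qed auto

text \<open>Substitutes whole blocks for the letters \<open>h n\<close> of a word without changing
  its product. Membership of the letters in the carrier is proved along with it because the
  induction step splits the word by \<open>unital_prod_append\<close>.\<close>

lemma unital_prod_fill_concat_expand:
  assumes "\<And>n a. (n, a) \<in> set ps \<Longrightarrow> G n \<noteq> [] \<and> f ` set (G n) \<subseteq> elts S \<and> a \<in> elts S \<and>
      unital_prod (map f (G n)) = Some (h n)"
  shows "set (fill f (concat (map (\<lambda>(n, a). expand (G n) a) ps))) \<subseteq> elts S \<and>
    unital_prod (fill f (concat (map (\<lambda>(n, a). expand (G n) a) ps))) = unital_prod (fill h ps)"
  using assms
proof (induction ps)
  case (Cons p ps)
  obtain n a where p: "p = (n, a)" by force
  have na: "G n \<noteq> []" "f ` set (G n) \<subseteq> elts S" "a \<in> elts S" "unital_prod (map f (G n)) = Some (h n)"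
    using Cons.prems p by auto
  have h: "h n \<in> elts S" using unital_prod_closed[OF _ na(4)] na(2) by simp
  let ?q = "fill f (concat (map (\<lambda>(n, a). expand (G n) a) ps))"
  have IH: "set ?q \<subseteq> elts S" "unital_prod ?q = unital_prod (fill h ps)" using Cons by auto
  have hps: "set (fill h ps) \<subseteq> elts S"
    using Cons.prems unital_prod_closed[of "map f (G _)"] unfolding set_fill by fastforce
  have "unital_prod (fill f (expand (G n) a)) = unital_prod (map f (G n) @ [a])"
    using unital_prod_fill_expand na by blast
  also have "\<dots> = unital_prod [h n, a]"
    using na h by (simp add: unital_prod_append)
  finally have "unital_prod (fill f (expand (G n) a) @ ?q) = unital_prod ([h n, a] @ fill h ps)"
    using unital_prod_append[OF set_fill_expand[OF na(2,3)] IH(1)] unital_prod_append[of "[h n, a]" "fill h ps"]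
      h na(3) hps IH(2) by simp
  then show ?case using IH(1) set_fill_expand[OF na(2,3)] by (simp add: p)
qed simp

lemma unital_prod_map_concat:
  assumes "\<And>n. n \<in> set ns \<Longrightarrow> f ` set (G n) \<subseteq> elts S \<and> unital_prod (map f (G n)) = Some (h n)"
  shows "unital_prod (map f (concat (map G ns))) = unital_prod (map h ns)"
  using assms
proof (induction ns)
  case (Cons n ns)
  have "f ` set (concat (map G ns)) \<subseteq> elts S" using Cons.prems by fastforce
  moreover have "h n \<in> elts S"
    using Cons.prems[of n] unital_prod_closed[of "map f (G n)"] by simp
  ultimately show ?case using Cons by (simp add: unital_prod_append)
qed simp

end

section \<open>Products over blocks\<close>

text \<open>The infinite counterpart of \<open>blocks\<close>, indexed from 1 because adequate
  sequences are functions on the positive integers; \<open>H 0\<close> is arbitrary.\<close>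

definition block_seq :: "(nat \<Rightarrow> nat set) \<Rightarrow> bool" where
  "block_seq H \<longleftrightarrow> (\<forall>n\<ge>1. H n \<in> Pf {1..}) \<and> (\<forall>i\<ge>1. \<forall>j>i. before (H i) (H j))"

text \<open>The blocks follow one another in the positive integers, so their minima grow by at least
  1 each time. This turns a lower bound on block numbers into one on indices, as condition (ii) of
  adequacy requires.\<close>

lemma block_seq_le:
  assumes "block_seq H" "n \<ge> 1" "x \<in> H n"
  shows "n \<le> x"
  using assms(2,3)
proof (induction n arbitrary: x rule: nat_induct_at_least)
  case base
  then show ?case using assms(1) by (auto simp: block_seq_def Pf_def)
next
  case (Suc n)
  then have "H n \<noteq> {}" using assms(1) by (auto simp: block_seq_def Pf_def)
  then obtain y where "y \<in> H n" by blast
  moreover have "before (H n) (H (Suc n))"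
    using assms(1) Suc.hyps by (simp add: block_seq_def)
  then have "y < x" using \<open>y \<in> H n\<close> Suc.prems by (auto simp: before_def)
  ultimately show ?case using Suc.IH by fastforce
qed

lemma sorted_wrt_concat_blocks:
  assumes "block_seq H" "sorted_wrt (<) ns" "set ns \<subseteq> {1..}"
  shows "sorted_wrt (<) (concat (map (\<lambda>n. sorted_list_of_set (H n)) ns))"
  using assms(2,3)
proof (induction ns)
  case (Cons n ns)
  have "x < y" if "x \<in> set (sorted_list_of_set (H n))" "m \<in> set ns"
    "y \<in> set (sorted_list_of_set (H m))" for x y m
  proof -
    have "finite (H n)" "finite (H m)" "before (H n) (H m)"
      using assms(1) Cons.prems that(2) by (auto simp: block_seq_def Pf_def)
    then show ?thesis using that(1,3) by (simp add: before_def)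
  qed
  then show ?case using Cons by (auto simp: sorted_wrt_append)
qed simp

lemma block_seq_finite: "block_seq H \<Longrightarrow> n \<ge> 1 \<Longrightarrow> finite (H n)"
  by (simp add: block_seq_def Pf_def)

lemma block_seq_UN_Pf: "block_seq H \<Longrightarrow> K \<in> Pf {1..} \<Longrightarrow> \<Union>(H ` K) \<in> Pf {1..}"
  unfolding block_seq_def Pf_def by (simp add: subset_iff) blast

lemma sorted_list_of_set_UN_blocks:
  assumes "block_seq H" "K \<in> Pf {1..}"
  shows "sorted_list_of_set (\<Union>(H ` K)) =
    concat (map (\<lambda>n. sorted_list_of_set (H n)) (sorted_list_of_set K))" (is "_ = ?c")
proof -
  have K: "finite K" "K \<subseteq> {1..}" using assms(2) by (auto simp: Pf_def)
  then have "sorted_wrt (<) ?c" by (intro sorted_wrt_concat_blocks assms) auto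
  moreover have "set ?c = \<Union>(H ` K)"
    using K block_seq_finite[OF assms(1)] by (auto simp: subset_iff)
  ultimately show ?thesis
    by (metis sorted_list_of_set.idem_if_sorted_distinct strict_sorted_iff)
qed

text \<open>\<open>the\<close> is harmless for adequate \<open>f\<close>, whose products are all
  defined; the restriction makes the result extensional, as membership in
  \<open>adequate_seqs\<close> demands.\<close>

definition block_products :: "'a psg \<Rightarrow> (nat \<Rightarrow> nat set) \<Rightarrow> (nat \<Rightarrow> 'a) \<Rightarrow> nat \<Rightarrow> 'a" where
  "block_products S H f = (\<lambda>n\<in>{1..}. the (seq_prod S f (H n)))"

lemma adequate_seqs_elts: "f \<in> adequate_seqs S \<Longrightarrow> n \<ge> 1 \<Longrightarrow> f n \<in> elts S"
  by (auto simp: adequate_seqs_def PiE_iff)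

context unital_psg
begin

lemma seq_prod_eq_unital_prod:
  assumes "f ` {1..} \<subseteq> elts S" "K \<in> Pf {1..}"
  shows "seq_prod S f K = unital_prod (map f (sorted_list_of_set K))"
  unfolding seq_prod_def
  using assms by (intro word_prod_eq_unital_prod) (auto simp: Pf_def subset_iff)

lemma block_products:
  assumes "f \<in> adequate_seqs S" "block_seq H" "n \<ge> 1"
  shows "unital_prod (map f (sorted_list_of_set (H n))) = Some (block_products S H f n)"
    and "f ` H n \<subseteq> elts S"
    and "block_products S H f n \<in> elts S"
proof -
  have f: "f ` {1..} \<subseteq> elts S" using assms(1) adequate_seqs_elts by blast
  have H: "H n \<in> Pf {1..}" using assms(2,3) by (simp add: block_seq_def)
  then show fH: "f ` H n \<subseteq> elts S" using f by (auto simp: Pf_def)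
  have "seq_prod S f (H n) \<noteq> None" using assms(1) H by (auto simp: adequate_seqs_def)
  then have "seq_prod S f (H n) = Some (block_products S H f n)"
    using assms(3) by (simp add: block_products_def)
  then show *: "unital_prod (map f (sorted_list_of_set (H n))) = Some (block_products S H f n)"
    using seq_prod_eq_unital_prod[OF f H] by simp
  show "block_products S H f n \<in> elts S"
    by (rule unital_prod_closed[OF _ *]) (use fH H in \<open>auto simp: Pf_def\<close>)
qed

lemma seq_prod_block_products:
  assumes "f \<in> adequate_seqs S" "block_seq H" "K \<in> Pf {1..}"
  shows "seq_prod S (block_products S H f) K = seq_prod S f (\<Union>(H ` K))"
proof -
  have K: "finite K" "K \<subseteq> {1..}" using assms(3) by (auto simp: Pf_def)
  have "unital_prod (map f (concat (map (\<lambda>n. sorted_list_of_set (H n)) (sorted_list_of_set K)))) =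
      unital_prod (map (block_products S H f) (sorted_list_of_set K))"
    by (rule unital_prod_map_concat)
      (use K block_products[OF assms(1,2)] block_seq_finite[OF assms(2)] in \<open>auto simp: subset_iff\<close>)
  moreover have f: "f ` {1..} \<subseteq> elts S" and g: "block_products S H f ` {1..} \<subseteq> elts S"
    using assms adequate_seqs_elts block_products(3) by auto
  ultimately show ?thesis
    unfolding seq_prod_eq_unital_prod[OF f block_seq_UN_Pf[OF assms(2,3)]] seq_prod_eq_unital_prod[OF g assms(3)]
      sorted_list_of_set_UN_blocks[OF assms(2,3)] by simp
qed

text \<open>Products of the new sequence are products of \<open>f\<close> over unions of blocks,
  hence defined; and the \<open>m\<close> that serves \<open>f\<close> for a given \<open>F\<close>
  serves the new sequence too, since block number \<open>n\<close> starts at \<open>n\<close> or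
  later.\<close>

lemma block_products_adequate:
  assumes "f \<in> adequate_seqs S" "block_seq H"
  shows "block_products S H f \<in> adequate_seqs S"
  unfolding adequate_seqs_def
proof (intro CollectI conjI ballI)
  show "block_products S H f \<in> {1..} \<rightarrow>\<^sub>E elts S"
    using block_products(3)[OF assms] by (auto simp: block_products_def)
next
  fix K :: "nat set" assume "K \<in> Pf {1..}"
  then show "seq_prod S (block_products S H f) K \<noteq> None"
    using assms block_seq_UN_Pf[OF assms(2)]
    unfolding seq_prod_block_products[OF assms \<open>K \<in> Pf {1..}\<close>] adequate_seqs_def by blast
next
  fix F assume "F \<in> Pf (elts S)"
  then obtain m where m: "m \<ge> 1" "\<forall>K\<in>Pf {1..}. m \<le> Min K \<longrightarrow> (\<exists>x\<in>sigma S F. seq_prod S f K = Some x)"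
    using assms(1) unfolding adequate_seqs_def by blast
  have "\<exists>x\<in>sigma S F. seq_prod S (block_products S H f) K = Some x"
    if K: "K \<in> Pf {1..}" "m \<le> Min K" for K :: "nat set"
  proof -
    have U: "\<Union>(H ` K) \<in> Pf {1..}" using block_seq_UN_Pf[OF assms(2) K(1)] .
    have "m \<le> x" if "n \<in> K" "x \<in> H n" for n x
    proof -
      have "m \<le> n" using K that(1) by (auto simp: Pf_def)
      also have "n \<le> x" using block_seq_le[OF assms(2) _ that(2)] K(1) that(1) by (auto simp: Pf_def)
      finally show ?thesis .
    qed
    then have "m \<le> Min (\<Union>(H ` K))" using U by (auto simp: Pf_def)
    then show ?thesis using m(2) U unfolding seq_prod_block_products[OF assms K(1)] by blast
  qed
  then show "\<exists>m\<ge>1. \<forall>K\<in>Pf {1..}. m \<le> Min K \<longrightarrow>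
      (\<exists>x\<in>sigma S F. seq_prod S (block_products S H f) K = Some x)"
    using m(1) by blast
qed

text \<open>Each pair \<open>(n, b)\<close> of a solution for the block products is expanded into
  the indices of \<open>H n\<close>, with identities in the inner gaps and \<open>b\<close> at the
  end. The expansion does not depend on \<open>f\<close>, so the same letters serve all of
  \<open>F\<close>.\<close>

lemma solutions_block_products:
  assumes "F \<subseteq> adequate_seqs S" "block_seq H" "K \<in> solutions S C (block_products S H ` F)"
  shows "\<Union>(H ` K) \<in> solutions S C F"
proof -
  obtain a ps where K: "K \<in> Pf {1..}" and ps: "a \<in> elts S" "map fst ps = sorted_list_of_set K"
      "snd ` set ps \<subseteq> elts S"
      "\<forall>f\<in>F. \<exists>x\<in>C. word_prod S (a # fill (block_products S H f) ps) = Some x"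
    using assms(3) by (auto simp: solutions_def)
  let ?G = "\<lambda>n. sorted_list_of_set (H n)"
  let ?qs = "concat (map (\<lambda>(n, a). expand (?G n) a) ps)"
  have fst_ps: "n \<ge> 1" if "(n, b) \<in> set ps" for n b
  proof -
    have "n \<in> set (map fst ps)" using that by force
    then show ?thesis using K unfolding ps(2) by (auto simp: Pf_def)
  qed
  have "map fst ?qs = concat (map ?G (map fst ps))"
    by (simp add: map_concat case_prod_unfold comp_def)
  then have 1: "map fst ?qs = sorted_list_of_set (\<Union>(H ` K))"
    using sorted_list_of_set_UN_blocks[OF assms(2) K] by (simp add: ps(2))
  have 2: "snd ` set ?qs \<subseteq> elts S"
    using snd_expand ps(3) e_elts by fastforce
  have "\<exists>x\<in>C. word_prod S (a # fill f ?qs) = Some x" if f: "f \<in> F" for f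
  proof -
    have "set (fill f ?qs) \<subseteq> elts S \<and> unital_prod (fill f ?qs) = unital_prod (fill (block_products S H f) ps)"
    proof (rule unital_prod_fill_concat_expand)
      fix n b assume nb: "(n, b) \<in> set ps"
      have "f \<in> adequate_seqs S" using f assms(1) by blast
      note bp = block_products[OF this assms(2) fst_ps[OF nb]]
      have "H n \<noteq> {}" "finite (H n)"
        using assms(2) fst_ps[OF nb] by (simp_all add: block_seq_def Pf_def)
      moreover have "b \<in> elts S" using nb ps(3) by force
      ultimately show "?G n \<noteq> [] \<and> f ` set (?G n) \<subseteq> elts S \<and> b \<in> elts S \<and>
          unital_prod (map f (?G n)) = Some (block_products S H f n)"
        using bp by simp
    qed
    moreover have "set (fill (block_products S H f) ps) \<subseteq> elts S"
      unfolding set_fill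
    proof (intro Un_least subsetI)
      fix y assume "y \<in> block_products S H f ` fst ` set ps"
      then obtain n b where "(n, b) \<in> set ps" "y = block_products S H f n" by force
      then show "y \<in> elts S" using block_products(3)[OF _ assms(2) fst_ps] f assms(1) by blast
    qed (use ps(3) in blast)
    moreover have "word_prod S (a # w) = unital_prod (a # w)" if "set w \<subseteq> elts S" for w
      using that ps(1) word_prod_eq_unital_prod[of "a # w"] by simp
    ultimately have "word_prod S (a # fill f ?qs) = word_prod S (a # fill (block_products S H f) ps)"
      by (metis unital_prod.simps(2))
    then show ?thesis using ps(4) f by simp
  qed
  then have 3: "\<forall>f\<in>F. \<exists>x\<in>C. word_prod S (a # fill f ?qs) = Some x" by blast
  show ?thesis
    unfolding solutions_def
    by (intro CollectI conjI bexI[of _ a] exI[of _ ?qs] block_seq_UN_Pf[OF assms(2) K] 1 2 3 ps(1))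
qed

text \<open>Given \<open>r\<close> blocks, the CR property is applied to the products over them; its
  bound \<open>r\<close> on the indices says that only the given blocks get used. This
  \<open>r\<close> depends on \<open>k\<close> and \<open>L\<close> but not on
  \<open>F\<close>.\<close>

lemma large_solutions:
  assumes "k_CR_set k S A" "L \<in> Pf (elts S)"
  shows "\<exists>r\<ge>1. \<forall>F\<in>Pf (adequate_seqs S). card F \<le> k \<longrightarrow>
    (\<forall>D. large (solutions S (A \<inter> sigma S L) F) r D)"
proof -
  from assms(1) have "\<forall>L\<in>Pf (elts S). \<exists>r\<ge>1. \<forall>F\<in>Pf (adequate_seqs S). card F \<le> k \<longrightarrow>
      (\<exists>H\<in>solutions S (A \<inter> sigma S L) F. H \<subseteq> {1..r})"
    unfolding k_CR_set_iff_solutions by (rule conjunct2)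
  from bspec[OF this assms(2)] obtain r where r: "r \<ge> 1"
      "\<forall>F\<in>Pf (adequate_seqs S). card F \<le> k \<longrightarrow> (\<exists>H\<in>solutions S (A \<inter> sigma S L) F. H \<subseteq> {1..r})"
    by (elim exE conjE)
  have "FU (set ys) \<inter> solutions S (A \<inter> sigma S L) F \<noteq> {}"
    if F: "F \<in> Pf (adequate_seqs S)" "card F \<le> k" and ys: "blocks ys" "length ys = r" for F ys
  proof -
    define M where "M = Max (\<Union>(set ys))"
    \<comment> \<open>Singletons beyond \<open>M\<close> prolong the list to an infinite block
      sequence, as block products need one. Since \<open>K\<close> will lie in
      \<open>{1..r}\<close>, the union taken at the end stays within \<open>ys\<close>.\<close>
    define H where "H n = (if n \<le> r then ys ! (n - 1) else {M + n})" for n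
    have Pf: "set ys \<subseteq> Pf {1..}" using ys(1) by (simp add: blocks_def)
    then have "finite (\<Union>(set ys))" by (auto simp: Pf_def)
    then have M: "x \<le> M" if "y \<in> set ys" "x \<in> y" for x y
      using that unfolding M_def by (intro Max_ge) auto
    have mem: "H n \<in> set ys" if "1 \<le> n" "n \<le> r" for n using that ys(2) by (simp add: H_def)
    have "H n \<in> Pf {1..}" if "n \<ge> 1" for n
      using mem[OF that] Pf that by (cases "n \<le> r") (auto simp: H_def Pf_def)
    moreover have "before (H i) (H j)" if "i \<ge> 1" "j > i" for i j
    proof (cases "j \<le> r")
      case True
      then show ?thesis
        using sorted_wrt_nth_less[of before ys "i - 1" "j - 1"] ys that
        by (auto simp: H_def blocks_def)
    next
      case False
      then show ?thesis
        using that M[OF mem[of i]] by (fastforce simp: H_def before_def)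
    qed
    ultimately have H: "block_seq H" by (simp add: block_seq_def)
    have "block_products S H ` F \<in> Pf (adequate_seqs S)"
      using F(1) block_products_adequate[OF _ H] by (auto simp: Pf_def)
    moreover have "card (block_products S H ` F) \<le> k"
      using card_image_le[of F "block_products S H"] F by (auto simp: Pf_def)
    ultimately obtain K where K: "K \<in> solutions S (A \<inter> sigma S L) (block_products S H ` F)" "K \<subseteq> {1..r}"
      using r(2) by meson
    have "\<Union>(H ` K) \<in> solutions S (A \<inter> sigma S L) F"
      using solutions_block_products[OF _ H K(1)] F(1) by (simp add: Pf_def)
    moreover have "K \<noteq> {}" using K(1) by (auto simp: solutions_def Pf_def)
    then have "\<Union>(H ` K) \<in> FU (set ys)"
      using mem K(2) unfolding FU_def by (intro CollectI exI[of _ "H ` K"]) auto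
    ultimately show ?thesis by blast
  qed
  then have "large (solutions S (A \<inter> sigma S L) F) r D"
    if "F \<in> Pf (adequate_seqs S)" "card F \<le> k" for F D
    using that unfolding large_def by simp
  with r(1) show ?thesis by (intro exI[of _ r]) simp
qed

end

section \<open>Cartesian products\<close>

lemma elts_prod_psg [simp]: "elts (prod_psg S T) = elts S \<times> elts T"
  by (simp add: prod_psg_def)

section \<open>Coordinatewise products and projections of sequences\<close>

lemma word_prod_prod_psg:
  "word_prod (prod_psg S T) ws = Some w \<longleftrightarrow>
    word_prod S (map fst ws) = Some (fst w) \<and> word_prod T (map snd ws) = Some (snd w)"
proof (induction ws arbitrary: w rule: induct_list012)
  case (3 x y zs)
  have *: "word_prod (prod_psg S T) (y # zs) = Some w \<longleftrightarrow>
      word_prod S (fst y # map fst zs) = Some (fst w) \<and> word_prod T (snd y # map snd zs) = Some (snd w)" for w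
    using 3 by simp
  show ?case
    by (auto simp: bind_eq_Some_conv pmul_prod_psg_eq_Some * simp del: word_prod.simps(1,2))
qed (auto simp: prod_eq_iff)

lemma phi_prod_psg: "phi (prod_psg S T) p = phi S (fst p) \<times> phi T (snd p)"
proof -
  have "pmul (prod_psg S T) p q \<noteq> None \<longleftrightarrow>
      pmul S (fst p) (fst q) \<noteq> None \<and> pmul T (snd p) (snd q) \<noteq> None" for q
    by (cases p; cases q) (auto simp: prod_psg_def bind_eq_None_conv split: bind_splits)
  then show ?thesis unfolding phi_def by auto
qed

lemma sigma_prod_psg:
  "(x, y) \<in> sigma (prod_psg S T) L \<longleftrightarrow> x \<in> sigma S (fst ` L) \<and> y \<in> sigma T (snd ` L)"
  by (auto simp: sigma_def phi_prod_psg)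

lemma seq_prod_restrict:
  "K \<subseteq> X \<Longrightarrow> finite K \<Longrightarrow> seq_prod S (restrict f X) K = seq_prod S f K"
  unfolding seq_prod_def by (rule arg_cong[of _ _ "word_prod S"]) auto

lemma seq_prod_prod_psg:
  "seq_prod (prod_psg S T) f K = Some w \<longleftrightarrow>
    seq_prod S (fst \<circ> f) K = Some (fst w) \<and> seq_prod T (snd \<circ> f) K = Some (snd w)"
  unfolding seq_prod_def word_prod_prod_psg by simp

text \<open>For condition (ii), a finite set \<open>F\<close> in \<open>S\<close> is lifted to
  \<open>F \<times> {t}\<close>; the first components of elements of \<open>sigma\<close> of the
  lifted set lie in \<open>sigma S F\<close>. Restricting the projection restores
  extensionality.\<close>

lemma fst_adequate:
  assumes "t \<in> elts T" "f \<in> adequate_seqs (prod_psg S T)"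
  shows "restrict (fst \<circ> f) {1..} \<in> adequate_seqs S"
  unfolding adequate_seqs_def
proof (intro CollectI conjI ballI)
  show "restrict (fst \<circ> f) {1..} \<in> {1..} \<rightarrow>\<^sub>E elts S"
    using adequate_seqs_elts[OF assms(2)] by (auto simp: mem_Times_iff)
next
  fix K :: "nat set" assume K: "K \<in> Pf {1..}"
  then have "seq_prod (prod_psg S T) f K \<noteq> None" using assms(2) by (auto simp: adequate_seqs_def)
  then show "seq_prod S (restrict (fst \<circ> f) {1..}) K \<noteq> None"
    using K seq_prod_prod_psg[of S T f K] by (auto simp: seq_prod_restrict Pf_def)
next
  fix F assume F: "F \<in> Pf (elts S)"
  then have "F \<times> {t} \<in> Pf (elts (prod_psg S T))" using assms(1) by (auto simp: Pf_def)
  then obtain m where m: "m \<ge> 1" "\<forall>K\<in>Pf {1..}. m \<le> Min K \<longrightarrow>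
      (\<exists>x\<in>sigma (prod_psg S T) (F \<times> {t}). seq_prod (prod_psg S T) f K = Some x)"
    using assms(2) unfolding adequate_seqs_def by blast
  have "\<exists>x\<in>sigma S F. seq_prod S (restrict (fst \<circ> f) {1..}) K = Some x"
    if K: "K \<in> Pf {1..}" "m \<le> Min K" for K :: "nat set"
  proof -
    obtain x y where "(x, y) \<in> sigma (prod_psg S T) (F \<times> {t})" "seq_prod (prod_psg S T) f K = Some (x, y)"
      using m(2) K by (metis surj_pair)
    then have "seq_prod S (fst \<circ> f) K = Some x" "x \<in> sigma S F"
      using F unfolding seq_prod_prod_psg sigma_prod_psg by (simp_all add: Pf_def)
    then show ?thesis using K(1) by (auto simp: seq_prod_restrict Pf_def)
  qed
  then show "\<exists>m\<ge>1. \<forall>K\<in>Pf {1..}. m \<le> Min K \<longrightarrow>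
      (\<exists>x\<in>sigma S F. seq_prod S (restrict (fst \<circ> f) {1..}) K = Some x)"
    using m(1) by blast
qed

lemma snd_adequate:
  assumes "s \<in> elts S" "f \<in> adequate_seqs (prod_psg S T)"
  shows "restrict (snd \<circ> f) {1..} \<in> adequate_seqs T"
  unfolding adequate_seqs_def
proof (intro CollectI conjI ballI)
  show "restrict (snd \<circ> f) {1..} \<in> {1..} \<rightarrow>\<^sub>E elts T"
    using adequate_seqs_elts[OF assms(2)] by (auto simp: mem_Times_iff)
next
  fix K :: "nat set" assume K: "K \<in> Pf {1..}"
  then have "seq_prod (prod_psg S T) f K \<noteq> None" using assms(2) by (auto simp: adequate_seqs_def)
  then show "seq_prod T (restrict (snd \<circ> f) {1..}) K \<noteq> None"
    using K seq_prod_prod_psg[of S T f K] by (auto simp: seq_prod_restrict Pf_def)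
next
  fix F assume F: "F \<in> Pf (elts T)"
  then have "{s} \<times> F \<in> Pf (elts (prod_psg S T))" using assms(1) by (auto simp: Pf_def)
  then obtain m where m: "m \<ge> 1" "\<forall>K\<in>Pf {1..}. m \<le> Min K \<longrightarrow>
      (\<exists>x\<in>sigma (prod_psg S T) ({s} \<times> F). seq_prod (prod_psg S T) f K = Some x)"
    using assms(2) unfolding adequate_seqs_def by blast
  have "\<exists>x\<in>sigma T F. seq_prod T (restrict (snd \<circ> f) {1..}) K = Some x"
    if K: "K \<in> Pf {1..}" "m \<le> Min K" for K :: "nat set"
  proof -
    obtain x y where "(x, y) \<in> sigma (prod_psg S T) ({s} \<times> F)" "seq_prod (prod_psg S T) f K = Some (x, y)"
      using m(2) K by (metis surj_pair)
    then have "seq_prod T (snd \<circ> f) K = Some y" "y \<in> sigma T F"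
      using F unfolding seq_prod_prod_psg sigma_prod_psg by (simp_all add: Pf_def)
    then show ?thesis using K(1) by (auto simp: seq_prod_restrict Pf_def)
  qed
  then show "\<exists>m\<ge>1. \<forall>K\<in>Pf {1..}. m \<le> Min K \<longrightarrow>
      (\<exists>x\<in>sigma T F. seq_prod T (restrict (snd \<circ> f) {1..}) K = Some x)"
    using m(1) by blast
qed

lemma fill_restrict: "fst ` set ps \<subseteq> X \<Longrightarrow> fill (restrict f X) ps = fill f ps"
  by (rule fill_cong) auto

lemma fill_zip:
  assumes "map fst ps = map fst qs"
  defines "rs \<equiv> zip (map fst ps) (zip (map snd ps) (map snd qs))"
  shows "map fst rs = map fst ps"
    and "map fst (fill f rs) = fill (fst \<circ> f) ps"
    and "map snd (fill f rs) = fill (snd \<circ> f) qs"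
    and "snd ` set rs \<subseteq> snd ` set ps \<times> snd ` set qs"
proof -
  have "length ps = length qs" using assms(1) map_eq_imp_length_eq by blast
  then have "map fst rs = map fst ps \<and> map fst (fill f rs) = fill (fst \<circ> f) ps \<and>
      map snd (fill f rs) = fill (snd \<circ> f) qs \<and> snd ` set rs \<subseteq> snd ` set ps \<times> snd ` set qs"
    using assms(1) unfolding rs_def by (induction ps qs rule: list_induct2) auto
  then show "map fst rs = map fst ps" "map fst (fill f rs) = fill (fst \<circ> f) ps"
      "map snd (fill f rs) = fill (snd \<circ> f) qs" "snd ` set rs \<subseteq> snd ` set ps \<times> snd ` set qs"
    by blast+
qed

text \<open>A common index set is all that the two coordinates must share: the letters of the two
  words are chosen separately and then paired. The indices are positive, so restricting the
  projections does not change the words.\<close>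

lemma solutions_prod_psg:
  assumes "H \<in> solutions S C ((\<lambda>f. restrict (fst \<circ> f) {1..}) ` F)"
    and "H \<in> solutions T D ((\<lambda>f. restrict (snd \<circ> f) {1..}) ` F)"
  shows "H \<in> solutions (prod_psg S T) (C \<times> D) F"
proof -
  obtain a ps where ps: "a \<in> elts S" "map fst ps = sorted_list_of_set H" "snd ` set ps \<subseteq> elts S"
      "\<forall>f\<in>F. \<exists>x\<in>C. word_prod S (a # fill (restrict (fst \<circ> f) {1..}) ps) = Some x"
    using assms(1) by (auto simp: solutions_def)
  obtain b qs where qs: "b \<in> elts T" "map fst qs = sorted_list_of_set H" "snd ` set qs \<subseteq> elts T"
      "\<forall>f\<in>F. \<exists>x\<in>D. word_prod T (b # fill (restrict (snd \<circ> f) {1..}) qs) = Some x"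
    using assms(2) by (auto simp: solutions_def)
  have H: "H \<in> Pf {1..}" using assms(1) by (simp add: solutions_def)
  have "fst ` set ps = H" "fst ` set qs = H"
    using arg_cong[OF ps(2), of set] arg_cong[OF qs(2), of set] H by (auto simp: Pf_def)
  then have res: "fill (restrict (fst \<circ> f) {1..}) ps = fill (fst \<circ> f) ps"
      "fill (restrict (snd \<circ> f) {1..}) qs = fill (snd \<circ> f) qs" for f
    using H by (simp_all add: fill_restrict Pf_def)
  have eq: "map fst ps = map fst qs" by (simp add: ps(2) qs(2))
  let ?rs = "zip (map fst ps) (zip (map snd ps) (map snd qs))"
  have "\<exists>w\<in>C \<times> D. word_prod (prod_psg S T) ((a, b) # fill f ?rs) = Some w" if f: "f \<in> F" for f
  proof -
    obtain x y where "x \<in> C" "word_prod S (a # fill (fst \<circ> f) ps) = Some x"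
        "y \<in> D" "word_prod T (b # fill (snd \<circ> f) qs) = Some y"
      using ps(4) qs(4) f unfolding res by blast
    then have "word_prod (prod_psg S T) ((a, b) # fill f ?rs) = Some (x, y)"
      unfolding word_prod_prod_psg using fill_zip(2,3)[OF eq] by simp
    then show ?thesis using \<open>x \<in> C\<close> \<open>y \<in> D\<close> by blast
  qed
  then have 1: "\<forall>f\<in>F. \<exists>w\<in>C \<times> D. word_prod (prod_psg S T) ((a, b) # fill f ?rs) = Some w"
    by blast
  have 2: "map fst ?rs = sorted_list_of_set H" using fill_zip(1)[OF eq] ps(2) by simp
  have 3: "snd ` set ?rs \<subseteq> elts (prod_psg S T)"
    unfolding elts_prod_psg
    by (rule subset_trans[OF fill_zip(4)[OF eq] Sigma_mono[OF ps(3) qs(3)]])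
  have 4: "(a, b) \<in> elts (prod_psg S T)" using ps(1) qs(1) by simp
  show ?thesis
    unfolding solutions_def
    by (intro CollectI conjI bexI[of _ "(a, b)"] exI[of _ ?rs] H 1 2 3 4)
qed

theorem theorem4p10:
  fixes S :: "'a psg" and T :: "'b psg" and A :: "'a set" and B :: "'b set"
  assumes "adequate_psg S" and "\<exists>e. two_sided_identity S e"
    and "adequate_psg T" and "\<exists>e. two_sided_identity T e"
    and "CR_set S A" and "CR_set T B"
  shows "CR_set (prod_psg S T) (A \<times> B)"
  unfolding CR_set_def
proof (intro allI impI)
  fix k :: nat assume "k \<ge> 1"
  then have A: "k_CR_set k S A" and B: "k_CR_set k T B"
    using assms(5,6) by (auto simp: CR_set_def)
  obtain d e where id: "two_sided_identity S d" "two_sided_identity T e" using assms(2,4) by blast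
  then have de: "d \<in> elts S" "e \<in> elts T" by (simp_all add: two_sided_identity_def)
  interpret S: unital_psg S d using assms(1) id by unfold_locales (simp_all add: adequate_psg_def)
  interpret T: unital_psg T e using assms(3) id by unfold_locales (simp_all add: adequate_psg_def)
  show "k_CR_set k (prod_psg S T) (A \<times> B)"
    unfolding k_CR_set_iff_solutions
  proof (intro conjI ballI)
    show "A \<times> B \<subseteq> elts (prod_psg S T)"
      using A B by (auto simp: k_CR_set_def)
  next
    fix L assume L: "L \<in> Pf (elts (prod_psg S T))"
    let ?P = "A \<inter> sigma S (fst ` L)" and ?Q = "B \<inter> sigma T (snd ` L)"
    have "fst ` L \<in> Pf (elts S)" "snd ` L \<in> Pf (elts T)"
      using L by (auto simp: Pf_def)
    from S.large_solutions[OF A this(1)] T.large_solutions[OF B this(2)] obtain n r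
      where n: "\<forall>F\<in>Pf (adequate_seqs S). card F \<le> k \<longrightarrow> (\<forall>D. large (solutions S ?P F) n D)"
        and r: "\<forall>F\<in>Pf (adequate_seqs T). card F \<le> k \<longrightarrow> (\<forall>D. large (solutions T ?Q F) r D)"
      by (elim exE conjE)
    \<comment> \<open>\<open>M\<close> is fixed before \<open>F\<close> enters, from the two bounds
      \<open>n\<close> and \<open>r\<close> alone.\<close>
    obtain M where M: "\<And>D G. \<lbrakk>blocks D; M \<le> length D; large G n D\<rbrakk> \<Longrightarrow>
        \<exists>ys. length ys = r \<and> blocks ys \<and> set ys \<subseteq> FU (set D) \<and> FU (set ys) \<subseteq> G"
      using finite_unions[of n r] by blast
    \<comment> \<open>The CR property asks for a bound of at least 1, and \<open>M\<close> might be
      0.\<close>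
    have "\<exists>H\<in>solutions (prod_psg S T) (A \<times> B \<inter> sigma (prod_psg S T) L) F. H \<subseteq> {1..max 1 M}"
      if F: "F \<in> Pf (adequate_seqs (prod_psg S T))" "card F \<le> k" for F
    proof -
      let ?F1 = "(\<lambda>f. restrict (fst \<circ> f) {1..}) ` F" and ?F2 = "(\<lambda>f. restrict (snd \<circ> f) {1..}) ` F"
      have F12: "?F1 \<in> Pf (adequate_seqs S)" "?F2 \<in> Pf (adequate_seqs T)"
        using F(1) fst_adequate[OF de(2)] snd_adequate[OF de(1)] unfolding Pf_def by blast+
      have "finite F" using F(1) by (simp add: Pf_def)
      then have cards: "card ?F1 \<le> k" "card ?F2 \<le> k"
        using F(2) by (meson card_image_le order_trans)+
      \<comment> \<open>Unions of these singletons are subsets of \<open>{1..M}\<close>, which gives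
        the bound on the indices.\<close>
      define D where "D = map (\<lambda>i. {i}) [1..<M + 1]"
      have "sorted_wrt before D"
        unfolding D_def sorted_wrt_map before_def by (simp del: upt_Suc)
      then have "blocks D" by (auto simp: D_def blocks_def Pf_def)
      moreover have "M \<le> length D" by (simp add: D_def del: upt_Suc)
      moreover have "large (solutions S ?P ?F1) n D" using n F12(1) cards(1) by blast
      ultimately obtain ys where ys: "length ys = r" "blocks ys" "set ys \<subseteq> FU (set D)"
          "FU (set ys) \<subseteq> solutions S ?P ?F1"
        using M[of D "solutions S ?P ?F1"] by blast
      \<comment> \<open>As \<open>ys\<close> consists of exactly \<open>r\<close> blocks, largeness
        for \<open>T\<close> finds one of its unions in the second family, and all its unions are
        already in the first.\<close>
      have "large (solutions T ?Q ?F2) r ys" using r F12(2) cards(2) by blast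
      then have "FU (set ys) \<inter> solutions T ?Q ?F2 \<noteq> {}"
        using ys(1,2) FU_incl[of "set ys"] by (simp add: large_def)
      then obtain H where H: "H \<in> FU (set ys)" "H \<in> solutions S ?P ?F1" "H \<in> solutions T ?Q ?F2"
        using ys(4) by blast
      have "H \<in> FU (set D)" using FU_subsetI[OF ys(3)] H(1) by blast
      then have "H \<subseteq> {1..max 1 M}" by (fastforce simp: FU_def D_def)
      moreover have "?P \<times> ?Q = A \<times> B \<inter> sigma (prod_psg S T) L"
        by (auto simp: sigma_prod_psg)
      then have "H \<in> solutions (prod_psg S T) (A \<times> B \<inter> sigma (prod_psg S T) L) F"
        using solutions_prod_psg[OF H(2,3)] by simp
      ultimately show ?thesis by blast
    qed
    then show "\<exists>r\<ge>1. \<forall>F\<in>Pf (adequate_seqs (prod_psg S T)). card F \<le> k \<longrightarrow>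
        (\<exists>H\<in>solutions (prod_psg S T) (A \<times> B \<inter> sigma (prod_psg S T) L) F. H \<subseteq> {1..r})"
      by (intro exI[of _ "max 1 M"]) simp
  qed
qed

end
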